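(* Let $S$ be a finite semigroup. The enhanced power graph $P_e(S)$ is equal to the power graph $\mathrm{Pow}(S)$ if and only if for each $a\in S$, there exist a prime $p$ and $n\in\mathbb{N}_0$ such that either $\langle a\rangle=M(m,p^n)$ where $m\in\{1,2\}$, or $\langle a\rangle=M(3,p^n)$ and $p$ is an odd prime.
   Context: $\mathbb{N}$ is the set of positive integers and $\mathbb{N}_0=\mathbb{N}\cup\{0\}$. For $a\in S$, $\langle a\rangle=\{a^k:k\in\mathbb{N}\}$. For an element $a$ of a finite semigroup, the index $m$ of $a$ is the least $x\in\mathbb{N}$ such that $a^x=a^y$ for some $y\in\mathbb{N}$, $y\neq x$, and the period $r$ of $a$ is the least $x\in\mathbb{N}$ with $a^{m+x}=a^m$; $\langle a\rangle=M(m,r)$ means that $a$ has index $m$ and period $r$. Both graphs are simple graphs with vertex set $S$. In $P_e(S)$, distinct $x,y$ are adjacent if and only if there is $z\in S$ with $x,y\in\langle z\rangle$. In $\mathrm{Pow}(S)$, distinct $x,y$ are adjacent if and only if $x=y^k$ or $y=x^k$ for some $k\in\mathbb{N}$. Two graphs on $S$ are equal if they have the same edges. *)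

theory Defs
  imports "HOL-Computational_Algebra.Primes" "Graph_Theory.Pair_Digraph"
begin

text \<open>
  The library's power operation requires a unit. The exponent 0 is junk here (it yields \<open>a\<close>) and is
  excluded wherever powers are used.
\<close>

definition sg_pow :: "'a::semigroup_mult \<Rightarrow> nat \<Rightarrow> 'a" where
  "sg_pow a k = ((\<lambda>x. x * a) ^^ (k - 1)) a"

lemma sg_pow_1: "sg_pow a 1 = a"
  by (simp add: sg_pow_def)

lemma sg_pow_Suc: "k \<ge> 1 \<Longrightarrow> sg_pow a (Suc k) = sg_pow a k * a"
  by (cases k) (simp_all add: sg_pow_def)

lemma sg_pow_eq_power:
  fixes a :: "'a::monoid_mult"
  shows "k \<ge> 1 \<Longrightarrow> sg_pow a k = a ^ k"
  by (induction k rule: dec_induct) (simp_all add: sg_pow_1[simplified] sg_pow_Suc power_Suc2 del: power_Suc)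

definition monogenic :: "'a::semigroup_mult \<Rightarrow> 'a set" where
  "monogenic a = {sg_pow a k | k. k \<ge> 1}"

text \<open>
  In a finite semigroup both minima below are attained. They are meaningless for elements with
  pairwise distinct powers.
\<close>

definition sg_index :: "'a::semigroup_mult \<Rightarrow> nat" where
  "sg_index a = (LEAST x. x \<ge> 1 \<and> (\<exists>y\<ge>1. y \<noteq> x \<and> sg_pow a x = sg_pow a y))"

definition sg_period :: "'a::semigroup_mult \<Rightarrow> nat" where
  "sg_period a = (LEAST x. x \<ge> 1 \<and> sg_pow a (sg_index a + x) = sg_pow a (sg_index a))"

text \<open>The assertion \<open>\<langle>a\<rangle> = M(m, r)\<close>, which by convention is about the index and period of \<open>a\<close>.\<close>

definition monogenic_is_M :: "'a::semigroup_mult \<Rightarrow> nat \<Rightarrow> nat \<Rightarrow> bool" where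
  "monogenic_is_M a m r \<longleftrightarrow> sg_index a = m \<and> sg_period a = r"

text \<open>
  A simple graph is represented by a symmetric, loop-free pair digraph (locale \<open>pair_graph\<close>): an
  undirected edge is a pair of opposite arcs. Equality of records is then equality of vertex sets
  and of edges.
\<close>

definition enhanced_power_graph :: "'a::semigroup_mult pair_pre_digraph" where
  "enhanced_power_graph =
     \<lparr> pverts = UNIV,
       parcs = {(x, y). x \<noteq> y \<and> (\<exists>z. x \<in> monogenic z \<and> y \<in> monogenic z)} \<rparr>"

definition power_graph :: "'a::semigroup_mult pair_pre_digraph" where
  "power_graph =
     \<lparr> pverts = UNIV,
       parcs = {(x, y). x \<noteq> y \<and> (\<exists>k\<ge>1. x = sg_pow y k \<or> y = sg_pow x k)} \<rparr>"

lemma pair_graph_enhanced_power_graph: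
  "pair_graph (enhanced_power_graph :: 'a::{semigroup_mult, finite} pair_pre_digraph)"
  by unfold_locales (auto simp: enhanced_power_graph_def symmetric_def arcs_ends_def arc_to_ends_def image_iff intro!: symI)

lemma pair_graph_power_graph:
  "pair_graph (power_graph :: 'a::{semigroup_mult, finite} pair_pre_digraph)"
  by unfold_locales (auto simp: power_graph_def symmetric_def arcs_ends_def arc_to_ends_def image_iff intro!: symI)

end

theory Submission
  imports Defs "HOL-Number_Theory.Cong"
begin

text \<open>
  Both graphs are decided inside the monogenic subsemigroups: they are equal exactly when, for
  every \<open>a\<close> and all exponents \<open>i\<close>, \<open>j\<close>, one of \<open>a\<^sup>i\<close>, \<open>a\<^sup>j\<close> is a power of the other
  (\<open>enhanced_power_graph_eq_power_graph_iff\<close>). If \<open>a\<close> has index \<open>m\<close> and period \<open>r\<close>, then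
  \<open>a\<^sup>i = a\<^sup>j\<close> holds iff \<open>i = j\<close>, or \<open>i\<close> and \<open>j\<close> are both at least \<open>m\<close> and congruent modulo \<open>r\<close>
  (\<open>sg_pow_eq_iff\<close>), so the question becomes one about congruences.

  For \<open>j \<ge> m\<close> the element \<open>a\<^sup>j\<close> is a power of \<open>a\<^sup>i\<close> as soon as \<open>gcd i r\<close> divides \<open>j\<close>, because
  \<open>i k \<equiv> j (mod r)\<close> then has arbitrarily large solutions \<open>k\<close>. When \<open>r\<close> is a prime power, the
  divisors \<open>gcd i r\<close> and \<open>gcd j r\<close> are comparable, so two exponents that are both at least \<open>m\<close> never
  cause an obstruction. The generator \<open>a\<close> itself causes none either, which settles \<open>m \<le> 2\<close>; for
  \<open>m = 3\<close> the only remaining exponent is \<open>2\<close>, and it is harmless when \<open>r\<close> is odd.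

  Conversely, if \<open>m \<ge> 4\<close>, or if \<open>m = 3\<close> and \<open>r\<close> is even, then \<open>a\<^sup>2\<close> and \<open>a\<^sup>3\<close> are incomparable; and if
  two distinct primes \<open>p\<close>, \<open>q\<close> divide \<open>r\<close>, then \<open>a\<^sup>p\<close> and \<open>a\<^sup>q\<close> are incomparable, since congruence
  modulo \<open>r\<close> preserves divisibility by \<open>p\<close> and by \<open>q\<close>.
\<close>

section \<open>Powers, index and period\<close>

lemma sg_pow_add:
  assumes "i \<ge> 1" "j \<ge> 1"
  shows "sg_pow a (i + j) = sg_pow a i * sg_pow a j"
  using assms(2)
proof (induction j rule: dec_induct)
  case base
  then show ?case using assms(1) sg_pow_Suc[of i a] sg_pow_1[of a] by simp
next
  case (step j)
  then show ?case using assms(1) by (simp add: sg_pow_Suc mult.assoc)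
qed

lemma sg_pow_mult:
  assumes "i \<ge> 1" "k \<ge> 1"
  shows "sg_pow a (i * k) = sg_pow (sg_pow a i) k"
  using assms(2)
proof (induction k rule: dec_induct)
  case base
  then show ?case using sg_pow_1[of "sg_pow a i"] by simp
next
  case (step k)
  have "sg_pow a (i * Suc k) = sg_pow a (i * k + i)" by (simp add: add.commute)
  also have "\<dots> = sg_pow a (i * k) * sg_pow a i"
    using assms(1) step.hyps by (intro sg_pow_add) auto
  finally show ?case using step by (simp add: sg_pow_Suc)
qed

lemma sg_pow_eq_shift:
  assumes "sg_pow a x = sg_pow a y" "x \<ge> 1" "y \<ge> 1"
  shows "sg_pow a (x + t) = sg_pow a (y + t)"
  using assms by (cases "t = 0") (auto simp: sg_pow_add)

lemma sg_index:
  fixes a :: "'a::{semigroup_mult, finite}"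
  shows "sg_index a \<ge> 1 \<and> (\<exists>y\<ge>1. y \<noteq> sg_index a \<and> sg_pow a (sg_index a) = sg_pow a y)"
proof -
  have "\<not> inj_on (sg_pow a) {1..}"
    using finite_imageD[of "sg_pow a" "{1..}"] infinite_Ici[of "1::nat"] by auto
  then obtain x y where "x \<ge> 1" "y \<ge> 1" "y \<noteq> x" "sg_pow a x = sg_pow a y"
    unfolding inj_on_def by force
  then have "\<exists>x. x \<ge> 1 \<and> (\<exists>y\<ge>1. y \<noteq> x \<and> sg_pow a x = sg_pow a y)" by blast
  then show ?thesis unfolding sg_index_def by (rule LeastI_ex)
qed

lemma sg_index_le:
  assumes "sg_pow a x = sg_pow a y" "x \<noteq> y" "x \<ge> 1" "y \<ge> 1"
  shows "sg_index a \<le> x"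
  unfolding sg_index_def by (rule Least_le) (use assms in force)

lemma sg_period:
  fixes a :: "'a::{semigroup_mult, finite}"
  shows "sg_period a \<ge> 1 \<and> sg_pow a (sg_index a + sg_period a) = sg_pow a (sg_index a)"
proof -
  obtain y where y: "y \<ge> 1" "y \<noteq> sg_index a" "sg_pow a (sg_index a) = sg_pow a y"
    using sg_index by blast
  have "sg_index a \<le> y" using sg_index_le[of a y "sg_index a"] y sg_index[of a] by simp
  then have "\<exists>x. x \<ge> 1 \<and> sg_pow a (sg_index a + x) = sg_pow a (sg_index a)"
    using y by (intro exI[of _ "y - sg_index a"]) auto
  then show ?thesis unfolding sg_period_def by (rule LeastI_ex)
qed

lemma sg_pow_add_period:
  fixes a :: "'a::{semigroup_mult, finite}"
  assumes "sg_index a \<le> x"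
  shows "sg_pow a (x + q * sg_period a) = sg_pow a x"
proof (induction q)
  case (Suc q)
  let ?m = "sg_index a" and ?r = "sg_period a"
  define t where "t = x + q * ?r - ?m"
  have t: "?m + t = x + q * ?r" using assms by (simp add: t_def)
  have "sg_pow a (?m + ?r + t) = sg_pow a (?m + t)"
    using sg_index[of a] sg_period[of a] by (intro sg_pow_eq_shift) auto
  moreover have "?m + ?r + t = x + Suc q * ?r" using t by simp
  ultimately show ?case using Suc t by simp
qed simp

lemma sg_pow_cong:
  fixes a :: "'a::{semigroup_mult, finite}"
  assumes "sg_index a \<le> x" "sg_index a \<le> y" "[x = y] (mod sg_period a)"
  shows "sg_pow a x = sg_pow a y"
  using assms
proof (induction x y rule: linorder_wlog)
  case (le x y)
  then obtain q where "y = x + q * sg_period a"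
    by (metis cong_le_nat cong_sym add.commute)
  then show ?case using sg_pow_add_period[of a x q] le by simp
next
  case (sym x y)
  then show ?case by (simp add: cong_sym)
qed

text \<open>
  For \<open>x \<le> y\<close>, the relation \<open>a\<^sup>x = a\<^sup>y\<close> can be transported around the cycle until it starts at the
  index, where the minimality of the period excludes a nonzero remainder of \<open>y - x\<close>.
\<close>

lemma sg_pow_eq_imp_cong:
  fixes a :: "'a::{semigroup_mult, finite}"
  assumes "sg_pow a x = sg_pow a y" "x \<ge> 1" "y \<ge> 1"
  shows "[x = y] (mod sg_period a)"
  using assms
proof (induction x y rule: linorder_wlog)
  case (le x y)
  let ?m = "sg_index a" and ?r = "sg_period a"
  define d where "d = y - x"
  define s where "s = d mod ?r"
  have r: "?r \<ge> 1" using sg_period by blast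
  \<comment> \<open>an exponent at least \<open>x\<close> that is congruent to the index modulo the period\<close>
  define z where "z = ?m + x * ?r"
  have zx: "x \<le> z" using r by (simp add: z_def trans_le_add2)
  have "sg_pow a (x + (z - x)) = sg_pow a (y + (z - x))"
    using le by (intro sg_pow_eq_shift)
  then have "sg_pow a z = sg_pow a (z + d)"
    using zx \<open>x \<le> y\<close> by (simp add: d_def add.commute)
  moreover have "sg_pow a z = sg_pow a ?m"
    unfolding z_def by (rule sg_pow_add_period) simp
  moreover have "sg_pow a (z + d) = sg_pow a (?m + s)"
  proof (rule sg_pow_cong)
    have "z + d = ?m + d + x * ?r" by (simp add: z_def)
    then show "[z + d = ?m + s] (mod ?r)"
      by (simp only: cong_def s_def mod_mult_self1 mod_add_right_eq)
  qed (simp_all add: z_def)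
  ultimately have eq: "sg_pow a (?m + s) = sg_pow a ?m" by simp
  have "s = 0"
  proof (rule ccontr)
    assume "s \<noteq> 0"
    then have "?r \<le> s" unfolding sg_period_def using eq by (intro Least_le) auto
    moreover have "s < ?r" unfolding s_def using r by (intro mod_less_divisor) simp
    ultimately show False by simp
  qed
  then have "?r dvd y - x" by (auto simp: s_def d_def)
  then have "[y = x] (mod ?r)" using \<open>x \<le> y\<close> by (simp add: cong_altdef_nat)
  then show ?case by (rule cong_sym)
next
  case (sym x y)
  then show ?case by (simp add: cong_sym)
qed

lemma sg_pow_eq_iff:
  fixes a :: "'a::{semigroup_mult, finite}"
  assumes "x \<ge> 1" "y \<ge> 1"
  shows "sg_pow a x = sg_pow a y \<longleftrightarrow>
    x = y \<or> sg_index a \<le> x \<and> sg_index a \<le> y \<and> [x = y] (mod sg_period a)"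
  using assms sg_pow_cong[of a x y] sg_pow_eq_imp_cong[of a x y]
    sg_index_le[of a x y] sg_index_le[of a y x] by metis

section \<open>Comparability of powers\<close>

definition powers_comparable :: "'a::semigroup_mult \<Rightarrow> nat \<Rightarrow> nat \<Rightarrow> bool" where
  "powers_comparable a i j \<longleftrightarrow>
     (\<exists>k\<ge>1. sg_pow a i = sg_pow a (j * k) \<or> sg_pow a j = sg_pow a (i * k))"

lemma powers_comparable_sym: "powers_comparable a i j \<longleftrightarrow> powers_comparable a j i"
  by (auto simp: powers_comparable_def)

lemma powers_comparable_1: "j \<ge> 1 \<Longrightarrow> powers_comparable a 1 j"
  unfolding powers_comparable_def by (rule exI[of _ j]) simp

lemma enhanced_power_graph_eq_power_graph_iff:
  "(enhanced_power_graph :: 'a::semigroup_mult pair_pre_digraph) = power_graph \<longleftrightarrow>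
    (\<forall>a::'a. \<forall>i\<ge>1. \<forall>j\<ge>1. powers_comparable a i j)"
proof -
  define E where "E x y \<longleftrightarrow> (\<exists>z. x \<in> monogenic z \<and> y \<in> monogenic z)" for x y :: 'a
  define P where "P x y \<longleftrightarrow> (\<exists>k\<ge>1. x = sg_pow y k \<or> y = sg_pow x k)" for x y :: 'a
  have self: "x \<in> monogenic x" for x :: 'a
    unfolding monogenic_def using sg_pow_1[of x] by force
  have PE: "E x y" if "P x y" for x y
    using that self unfolding E_def P_def monogenic_def by blast
  have PP: "P x x" for x
    unfolding P_def using sg_pow_1[of x] by (intro exI[of _ 1]) simp
  have comp: "powers_comparable a i j \<longleftrightarrow> P (sg_pow a i) (sg_pow a j)"
    if "i \<ge> 1" "j \<ge> 1" for a :: 'a and i j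
    unfolding powers_comparable_def P_def using that by (auto simp: sg_pow_mult)
  have "(enhanced_power_graph :: 'a pair_pre_digraph) = power_graph \<longleftrightarrow>
      {(x, y). x \<noteq> y \<and> E x y} = {(x, y). x \<noteq> y \<and> P x y}"
    by (simp add: enhanced_power_graph_def power_graph_def E_def P_def)
  also have "\<dots> \<longleftrightarrow> (\<forall>x y. E x y \<longrightarrow> P x y)"
    unfolding set_eq_iff using PE PP by (simp split: prod.splits) metis
  also have "\<dots> \<longleftrightarrow> (\<forall>a::'a. \<forall>i\<ge>1. \<forall>j\<ge>1. P (sg_pow a i) (sg_pow a j))"
    unfolding E_def monogenic_def by blast
  finally show ?thesis using comp by simp
qed

text \<open>
  Above the index, comparability is the solvability of \<open>i k \<equiv> j\<close> modulo the period. Adding a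
  multiple of the period to \<open>k\<close> brings \<open>i k\<close> above the index as well.
\<close>

lemma powers_comparable_if_gcd_dvd:
  fixes a :: "'a::{semigroup_mult, finite}"
  assumes "i \<ge> 1" "sg_index a \<le> j" "gcd i (sg_period a) dvd j"
  shows "powers_comparable a i j"
proof -
  let ?m = "sg_index a" and ?r = "sg_period a"
  have r: "?r \<ge> 1" using sg_period by blast
  have m: "?m \<ge> 1" using sg_index by blast
  obtain c where "[i * c = gcd i ?r] (mod ?r)"
    using cong_solve_nat[of i ?r] assms(1) by auto
  moreover obtain e where e: "j = gcd i ?r * e" using assms(3) by (elim dvdE)
  ultimately have c: "[i * c * e = j] (mod ?r)" by (metis cong_scalar_right)
  define k where "k = c * e + ?m * ?r"
  have "?m \<le> ?m * ?r" using r by simp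
  then have mk: "?m \<le> k" unfolding k_def by (rule trans_le_add2)
  then have "?m \<le> i * k" using assms(1) by (metis le_trans mult_le_mono1 nat_mult_1)
  moreover have "i * k = i * c * e + i * ?m * ?r" by (simp add: k_def algebra_simps)
  then have "[j = i * k] (mod ?r)" using c by (simp add: cong_def)
  ultimately have "sg_pow a j = sg_pow a (i * k)" using assms(2) by (intro sg_pow_cong)
  then show ?thesis unfolding powers_comparable_def using m mk by (intro exI[of _ k]) simp
qed

lemma powers_comparable_above_index:
  fixes a :: "'a::{semigroup_mult, finite}"
  assumes "prime p" "sg_period a = p ^ n" "i \<ge> sg_index a" "j \<ge> sg_index a"
  shows "powers_comparable a i j"
proof -
  let ?r = "sg_period a"
  have ij: "i \<ge> 1" "j \<ge> 1" using sg_index[of a] assms(3,4) by auto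
  obtain u where u: "gcd i ?r = p ^ u"
    using divides_primepow_nat[OF assms(1), of "gcd i ?r" n] assms(2) by auto
  obtain v where v: "gcd j ?r = p ^ v"
    using divides_primepow_nat[OF assms(1), of "gcd j ?r" n] assms(2) by auto
  show ?thesis
  proof (cases "u \<le> v")
    case True
    then have "gcd i ?r dvd gcd j ?r" by (simp add: u v le_imp_power_dvd)
    then have "gcd i ?r dvd j" by (meson dvd_trans gcd_dvd1)
    then show ?thesis using ij assms by (intro powers_comparable_if_gcd_dvd)
  next
    case False
    then have "gcd j ?r dvd gcd i ?r" by (simp add: u v le_imp_power_dvd)
    then have "gcd j ?r dvd i" by (meson dvd_trans gcd_dvd1)
    then have "powers_comparable a j i" using ij assms by (intro powers_comparable_if_gcd_dvd)
    then show ?thesis by (simp add: powers_comparable_sym)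
  qed
qed

text \<open>
  Two exponents at least \<open>2\<close> that are not both above the index include the exponent \<open>2\<close>, with
  index \<open>3\<close>; the gcd of \<open>2\<close> with an odd period is \<open>1\<close>, so nothing obstructs comparability.
\<close>

lemma powers_comparable_if_prime_power_period:
  fixes a :: "'a::{semigroup_mult, finite}"
  assumes p: "prime p" "sg_period a = p ^ n"
    and m: "sg_index a \<le> 2 \<or> sg_index a = 3 \<and> odd p"
    and "i \<ge> 1" "j \<ge> 1"
  shows "powers_comparable a i j"
  using assms(4,5)
proof (induction i j rule: linorder_wlog)
  case (le i j)
  consider "i = 1" | "sg_index a \<le> i" | "i = 2" "j = 2" | "i = 2" "sg_index a \<le> j" "odd p"
    using m le by force
  then show ?case
  proof cases
    case 1
    then show ?thesis using le powers_comparable_1 by blast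
  next
    case 2
    then show ?thesis using p le by (intro powers_comparable_above_index) auto
  next
    case 3
    then show ?thesis by (auto simp: powers_comparable_def intro: exI[of _ 1])
  next
    case 4
    then have "odd (sg_period a)" using p by simp
    then have "gcd i (sg_period a) = 1"
      using 4 by (simp flip: coprime_iff_gcd_eq_1)
    then show ?thesis using 4 by (intro powers_comparable_if_gcd_dvd) auto
  qed
next
  case (sym i j)
  then show ?case by (simp add: powers_comparable_sym)
qed

section \<open>Obstructions to comparability\<close>

text \<open>
  An index above \<open>2\<close> makes \<open>a\<^sup>2\<close> differ from all other powers of \<open>a\<close>, hence not a power of \<open>a\<^sup>3\<close>.
  So \<open>a\<^sup>3\<close> must be an even power of \<open>a\<close>, which forces a coincidence of powers at exponent \<open>3\<close>
  between exponents of different parity.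
\<close>

lemma index_and_period_if_square_cube_comparable:
  fixes a :: "'a::{semigroup_mult, finite}"
  assumes "powers_comparable a 2 3"
  shows "sg_index a \<le> 2 \<or> sg_index a = 3 \<and> odd (sg_period a)"
proof (rule ccontr)
  assume *: "\<not> ?thesis"
  obtain k where k: "k \<ge> 1" "sg_pow a 2 = sg_pow a (3 * k) \<or> sg_pow a 3 = sg_pow a (2 * k)"
    using assms unfolding powers_comparable_def by blast
  have "2 \<noteq> 3 * k" "3 \<noteq> 2 * k" by presburger+
  then have "sg_index a \<le> 3" "[3 = 2 * k] (mod sg_period a)"
    using k * sg_pow_eq_iff[of 2 "3 * k" a] sg_pow_eq_iff[of 3 "2 * k" a] by auto
  moreover from this have "even (sg_period a)" using * by auto
  ultimately have "[3 = 2 * k] (mod 2)" using cong_dvd_modulus_nat by blast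
  then show False by (simp add: cong_def)
qed

text \<open>
  A power of \<open>a\<^sup>p\<close> has an exponent divisible by \<open>p\<close>, and since \<open>p\<close> divides the period, so has every
  exponent that yields the same element. Hence \<open>a\<^sup>q\<close> can be a power of \<open>a\<^sup>p\<close> only if \<open>p\<close> divides \<open>q\<close>.
\<close>

lemma prime_divisors_of_period_eq:
  fixes a :: "'a::{semigroup_mult, finite}"
  assumes "powers_comparable a p q"
    and "prime p" "p dvd sg_period a" "prime q" "q dvd sg_period a"
  shows "p = q"
proof -
  have eq_if_power: "s = t"
    if "prime s" "s dvd sg_period a" "prime t" "k \<ge> 1" "sg_pow a t = sg_pow a (s * k)"
    for s t k :: nat
  proof -
    have "[t = s * k] (mod sg_period a)"
      using that prime_gt_0_nat by (intro sg_pow_eq_imp_cong) (auto simp: Suc_le_eq)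
    then have "[t = s * k] (mod s)"
      using that(2) cong_dvd_modulus_nat by blast
    then have "s dvd t" using cong_dvd_iff by (metis dvd_triv_left)
    then show ?thesis using that primes_dvd_imp_eq by blast
  qed
  then show ?thesis using assms unfolding powers_comparable_def by metis
qed

lemma prime_power_if_unique_prime_divisor:
  fixes r :: nat
  assumes "r \<ge> 1" and uniq: "\<And>p q. prime p \<Longrightarrow> p dvd r \<Longrightarrow> prime q \<Longrightarrow> q dvd r \<Longrightarrow> p = q"
  obtains p n where "prime p" "r = p ^ n" "odd r \<Longrightarrow> odd p"
proof (cases "r = 1")
  case True
  \<comment> \<open>every prime has the power 1; an odd one is chosen\<close>
  then show ?thesis using that[of 3 0] by simp
next
  case False
  then obtain p where p: "prime p" "p dvd r" using prime_factor_nat by blast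
  obtain s where s: "r = p ^ multiplicity p r * s" "\<not> p dvd s"
    using multiplicity_decompose'[of r p] assms(1) p(1) by (metis not_one_le_zero not_prime_unit)
  have "s = 1"
  proof (rule ccontr)
    assume "s \<noteq> 1"
    then obtain q where "prime q" "q dvd s" using prime_factor_nat by blast
    then show False using uniq[OF p, of q] s by (metis dvd_mult)
  qed
  then show ?thesis using that[of p "multiplicity p r"] p s(1) by (metis dvd_trans mult_1_right)
qed

section \<open>The characterization\<close>

theorem theorem4p8:
  shows "(enhanced_power_graph :: 'a::{semigroup_mult, finite} pair_pre_digraph) = power_graph \<longleftrightarrow>
    (\<forall>a::'a. \<exists>(p::nat) (n::nat). prime p \<and>
       ((\<exists>m\<in>{1, 2}. monogenic_is_M a m (p ^ n)) \<or>
        (monogenic_is_M a 3 (p ^ n) \<and> odd p)))"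
proof -
  have "(\<forall>i\<ge>1. \<forall>j\<ge>1. powers_comparable a i j) \<longleftrightarrow>
      (\<exists>(p::nat) (n::nat). prime p \<and>
       ((\<exists>m\<in>{1, 2}. monogenic_is_M a m (p ^ n)) \<or>
        (monogenic_is_M a 3 (p ^ n) \<and> odd p)))" for a :: 'a
  proof
    assume comp: "\<forall>i\<ge>1. \<forall>j\<ge>1. powers_comparable a i j"
    then have m: "sg_index a \<le> 2 \<or> sg_index a = 3 \<and> odd (sg_period a)"
      by (intro index_and_period_if_square_cube_comparable) simp
    have "sg_period a \<ge> 1" using sg_period by blast
    moreover have "p = q"
      if "prime p" "p dvd sg_period a" "prime q" "q dvd sg_period a" for p q
      using that comp prime_gt_0_nat
      by (intro prime_divisors_of_period_eq[of a]) (auto simp: Suc_le_eq)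
    ultimately obtain p n where pn: "prime p" "sg_period a = p ^ n" "odd (sg_period a) \<Longrightarrow> odd p"
      using prime_power_if_unique_prime_divisor by blast
    moreover have "sg_index a \<in> {1, 2} \<or> sg_index a = 3 \<and> odd p"
      using m pn(3) sg_index[of a] by auto
    ultimately show "\<exists>(p::nat) (n::nat). prime p \<and>
       ((\<exists>m\<in>{1, 2}. monogenic_is_M a m (p ^ n)) \<or> (monogenic_is_M a 3 (p ^ n) \<and> odd p))"
      unfolding monogenic_is_M_def by blast
  next
    assume "\<exists>(p::nat) (n::nat). prime p \<and>
       ((\<exists>m\<in>{1, 2}. monogenic_is_M a m (p ^ n)) \<or> (monogenic_is_M a 3 (p ^ n) \<and> odd p))"
    then obtain p n where pn: "prime p" "sg_period a = p ^ n"
      and "sg_index a \<le> 2 \<or> sg_index a = 3 \<and> odd p"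
      unfolding monogenic_is_M_def by auto
    then show "\<forall>i\<ge>1. \<forall>j\<ge>1. powers_comparable a i j"
      using powers_comparable_if_prime_power_period by blast
  qed
  then show ?thesis unfolding enhanced_power_graph_eq_power_graph_iff by blast
qed

end
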